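(* Let $d\ge1$ be an integer dividing $q+1$ and let $k$ be an integer with $1\le k<d$. Let \[\zeta=\pi_F(1-y^{q-1})^{-k/d}\sum_{m=0}^\infty(-1)^m\binom{k/d}{m}y^{(q-1)m}\left[\frac{(1-y)^{\mu_m}-1}{\mu_m\,y}\right]\in K[[y]],\qquad \mu_m:=1+\frac{qk}{d}-(q-1)m.\] Then the coefficients of $\zeta$ are unbounded (with respect to the absolute value of $K$).
   Context: $F$ is a finite extension of $\mathbb{Q}_p$ with uniformiser $\pi_F$ and residue field of size $q$; $K$ is a complete field extension of $F$. For $\alpha\in\mathbb{Z}_p$, $(1-y)^\alpha=\sum_n\binom{\alpha}{n}(-y)^n\in\mathbb{Z}_p[[y]]$ denotes the binomial series and $\binom{\alpha}{n}=\alpha(\alpha-1)\cdots(\alpha-n+1)/n!$; since $k/d\notin\mathbb{Z}$ and $d\mid q+1$, each $\mu_m$ is a non-zero element of $\mathbb{Z}_p$, and each bracket is a power series in $y$. *)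

theory Defs
  imports "HOL-Analysis.Analysis" "HOL-Computational_Algebra.Computational_Algebra"
begin

definition nonarch_abs :: "('a::field \<Rightarrow> real) \<Rightarrow> bool" where
  "nonarch_abs v \<longleftrightarrow>
     (\<forall>x. 0 \<le> v x) \<and> (\<forall>x. v x = 0 \<longleftrightarrow> x = 0) \<and>
     (\<forall>x y. v (x * y) = v x * v y) \<and> (\<forall>x y. v (x + y) \<le> max (v x) (v y))"

definition abs_dist :: "('a::field \<Rightarrow> real) \<Rightarrow> 'a \<Rightarrow> 'a \<Rightarrow> real" where
  "abs_dist v x y = v (x - y)"

definition is_subfield :: "'a::field set \<Rightarrow> bool" where
  "is_subfield S \<longleftrightarrow> 0 \<in> S \<and> 1 \<in> S \<and>
     (\<forall>x\<in>S. \<forall>y\<in>S. x - y \<in> S \<and> x * y \<in> S) \<and> (\<forall>x\<in>S. inverse x \<in> S)"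

definition padic_abs :: "nat \<Rightarrow> rat \<Rightarrow> real" where
  "padic_abs p r = (if r = 0 then 0
     else let (a, b) = quotient_of r in
       real p powi (int (multiplicity (int p) b) - int (multiplicity (int p) a)))"

(* Q is the completion of the rational numbers (which lie in the ambient field, as it has
   characteristic 0) with respect to the p-adic absolute value. The exponent c allows any
   normalisation of the absolute value of the ambient field, e.g. v p = 1/p, or
   v u = 1/q for a uniformiser u of a finite extension. *)
definition padic_numbers :: "nat \<Rightarrow> ('a::field_char_0 \<Rightarrow> real) \<Rightarrow> 'a set \<Rightarrow> bool" where
  "padic_numbers p v Q \<longleftrightarrow> is_subfield Q \<and>
     (\<exists>c>0. \<forall>r. v (of_rat r) = padic_abs p r powr c) \<and>
     Metric_space.mcomplete Q (abs_dist v) \<and>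
     Metric_space.mtopology Q (abs_dist v) closure_of \<rat> = Q"

definition finite_extension :: "'a::field set \<Rightarrow> 'a set \<Rightarrow> bool" where
  "finite_extension Q F \<longleftrightarrow> is_subfield Q \<and> is_subfield F \<and> Q \<subseteq> F \<and>
     (\<exists>B. finite B \<and> B \<subseteq> F \<and> (\<forall>x\<in>F. \<exists>c. (\<forall>b\<in>B. c b \<in> Q) \<and> x = (\<Sum>b\<in>B. c b * b)))"

definition val_ring :: "('a::field \<Rightarrow> real) \<Rightarrow> 'a set \<Rightarrow> 'a set" where
  "val_ring v F = {x \<in> F. v x \<le> 1}"

definition max_ideal :: "('a::field \<Rightarrow> real) \<Rightarrow> 'a set \<Rightarrow> 'a set" where
  "max_ideal v F = {x \<in> F. v x < 1}"

definition uniformiser :: "('a::field \<Rightarrow> real) \<Rightarrow> 'a set \<Rightarrow> 'a \<Rightarrow> bool" where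
  "uniformiser v F u \<longleftrightarrow> u \<in> val_ring v F \<and> max_ideal v F = (\<lambda>x. u * x) ` val_ring v F"

definition residue_field :: "('a::field \<Rightarrow> real) \<Rightarrow> 'a set \<Rightarrow> 'a set set" where
  "residue_field v F =
     val_ring v F // {(x, y). x \<in> val_ring v F \<and> y \<in> val_ring v F \<and> x - y \<in> max_ideal v F}"

text \<open>The binomial series \<open>(1 - y)\<^sup>\<alpha>\<close>.\<close>
definition binom_series :: "'a::field_char_0 \<Rightarrow> 'a fps" where
  "binom_series \<alpha> = Abs_fps (\<lambda>n. (\<alpha> gchoose n) * (- 1) ^ n)"

definition mu :: "nat \<Rightarrow> nat \<Rightarrow> nat \<Rightarrow> nat \<Rightarrow> 'a::field_char_0" where
  "mu q d k m = 1 + of_nat q * of_nat k / of_nat d - (of_nat q - 1) * of_nat m"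

(* The infinite sum is the limit for the X-adic topology of the type of formal power series:
   the m-th summand is divisible by X ^ ((q - 1) * m). *)
definition zeta :: "'a::field_char_0 \<Rightarrow> nat \<Rightarrow> nat \<Rightarrow> nat \<Rightarrow> 'a fps" where
  "zeta \<pi> q d k =
     fps_const \<pi> * (binom_series (- (of_nat k / of_nat d)) oo fps_X ^ (q - 1)) *
     (\<Sum>m. (- 1) ^ m * fps_const ((of_nat k / of_nat d) gchoose m) * fps_X ^ ((q - 1) * m) *
        ((binom_series (mu q d k m) - 1) / (fps_const (mu q d k m) * fps_X)))"

end

theory Submission
  imports Defs "HOL-Number_Theory.Cong" "HOL-Algebra.Sylow" "HOL-Algebra.Multiplicative_Group"
begin

text \<open>
  Write \<open>a = k / d\<close>. The factor \<open>(1 - y\<^sup>q\<^sup>-\<^sup>1)\<^sup>-\<^sup>a\<close> is invertible among the series with coefficients of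
  absolute value at most 1, so only the sum over \<open>m\<close> matters. Its coefficient at \<open>y\<^sup>N\<^sup>-\<^sup>1\<close> is the sum
  over \<open>m\<close>, with \<open>r = N - (q - 1) m > 0\<close>, of \<open>\<plusminus> (a gchoose m) (\<mu>\<^sub>m - 1 gchoose r - 1) / r\<close>.
  The valuation of \<open>a gchoose m\<close> is the number of \<open>s \<ge> 1\<close> with \<open>a mod p\<^sup>s < m mod p\<^sup>s\<close>. Let \<open>m\<^sub>0\<close> be
  the residue modulo \<open>p\<^sup>L\<close> of the zero \<open>b = (1 + q a) / (q - 1)\<close> of \<open>m \<mapsto> \<mu>\<^sub>m\<close>, and take
  \<open>N = (q - 1) m\<^sub>0 + p\<^sup>L\<close>. If \<open>m\<^sub>0 \<le> a mod p\<^sup>L\<close>, the term of \<open>m\<^sub>0\<close> strictly dominates all others, and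
  its valuation is minus the number of \<open>s \<le> L\<close> with \<open>b mod p\<^sup>s \<le> a mod p\<^sup>s\<close>. There are infinitely
  many such \<open>s\<close>, because the residues of \<open>a\<close> and \<open>b\<close> modulo powers of \<open>q\<close> are explicit.
\<close>

subsection \<open>Valuations of binomial coefficients\<close>

lemma multiplicity_eq_card_dvd:
  fixes x :: int
  assumes "prime p" "x \<noteq> 0" "multiplicity (int p) x \<le> S"
  shows "multiplicity (int p) x = (\<Sum>s\<in>{1..S}. of_bool (int p ^ s dvd x))"
proof -
  have "\<not> is_unit (int p)" using assms(1) by (metis not_prime_unit prime_nat_int_transfer)
  then have "{s\<in>{1..S}. int p ^ s dvd x} = {1..multiplicity (int p) x}"
    using assms by (auto simp: power_dvd_iff_le_multiplicity)
  moreover have "(\<Sum>s\<in>{1..S}. of_bool (int p ^ s dvd x)) = card {s\<in>{1..S}. int p ^ s dvd x}"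
    by (simp add: sum.If_cases of_bool_def Int_def)
  ultimately show ?thesis by simp
qed

text \<open>Each full block of \<open>P\<close> consecutive integers meets the class of
  \<open>A\<close> once; the incomplete last block covers exactly the residues below
  \<open>n mod P\<close>.\<close>

lemma sum_mod_eq:
  fixes A P n :: nat
  assumes "A < P"
  shows "(\<Sum>i<n. of_bool (i mod P = A)) = n div P + of_bool (A < n mod P)"
  using assms by (induction n) (auto simp: mod_Suc div_Suc)

lemma sum_dvd_Suc:
  fixes P n :: nat
  assumes "0 < P"
  shows "(\<Sum>i<n. of_bool (P dvd Suc i)) = n div P"
  using assms by (induction n) (auto simp: div_Suc dvd_eq_mod_eq_0)

lemma nonarch_abs_1:
  assumes "nonarch_abs v"
  shows "v 1 = 1"
proof -
  have "v (1 * 1) = v 1 * v 1" "v 1 \<noteq> 0" using assms zero_neq_one unfolding nonarch_abs_def by metis+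
  then show ?thesis by simp
qed

lemma nonarch_abs_minus:
  assumes "nonarch_abs v"
  shows "v (- x) = v x"
proof -
  have mult: "v (x * y) = v x * v y" and nonneg: "0 \<le> v x" for x y
    using assms by (auto simp: nonarch_abs_def)
  have "v (- 1) * v (- 1) = 1" using mult[of "- 1" "- 1"] nonarch_abs_1[OF assms] by simp
  then have "v (- 1) = 1" using nonneg[of "- 1"]
    by (simp add: power2_eq_square[symmetric] power2_eq_1_iff)
  then show ?thesis using mult[of "- 1" x] by simp
qed

text \<open>\<open>\<rho>\<close> is the absolute value of \<open>p\<close>; leaving it arbitrary
  between 0 and 1 covers every normalisation allowed by \<open>padic_numbers\<close>.\<close>

locale padic_norm =
  fixes v :: "'a::field_char_0 \<Rightarrow> real" and p :: nat and \<rho> :: real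
  assumes prime_p: "prime p" and nonarch: "nonarch_abs v" and rho: "0 < \<rho>" "\<rho> < 1"
    and v_of_int: "x \<noteq> 0 \<Longrightarrow> v (of_int x) = \<rho> ^ multiplicity (int p) x"
begin

lemma v_nonneg: "0 \<le> v x" and v_eq_0: "v x = 0 \<longleftrightarrow> x = 0"
  and v_mult: "v (x * y) = v x * v y" and v_add: "v (x + y) \<le> max (v x) (v y)"
  using nonarch by (auto simp: nonarch_abs_def)

lemmas v_one = nonarch_abs_1[OF nonarch] and v_minus = nonarch_abs_minus[OF nonarch]

lemma v_prod: "v (\<Prod>i\<in>I. f i) = (\<Prod>i\<in>I. v (f i))"
  by (induction I rule: infinite_finite_induct) (auto simp: v_one v_mult)

lemma v_power: "v (x ^ n) = v x ^ n"
  by (induction n) (auto simp: v_one v_mult)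

lemma v_divide: "v (x / y) = v x / v y"
proof (cases "y = 0")
  case False
  then have "v (x / y) * v y = v x" using v_mult[of "x / y" y] by simp
  then show ?thesis using False v_eq_0[of y] by (simp add: field_simps)
qed (use v_eq_0[of 0] in simp)

lemma v_sum_le: "0 \<le> B \<Longrightarrow> (\<And>i. i \<in> I \<Longrightarrow> v (f i) \<le> B) \<Longrightarrow> v (\<Sum>i\<in>I. f i) \<le> B"
proof (induction I rule: infinite_finite_induct)
  case (insert x F)
  then show ?case using v_add[of "f x" "sum f F"] by fastforce
qed (use v_eq_0[of 0] in auto)

lemma v_add_eq: "v y < v x \<Longrightarrow> v (x + y) = v x"
  using v_add[of x y] v_add[of "x + y" "- y"] v_minus[of y] by auto

lemma v_of_nat: "n \<noteq> 0 \<Longrightarrow> v (of_nat n) = \<rho> ^ multiplicity (int p) (int n)"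
  using v_of_int[of "int n"] by simp

lemma v_of_int_dvd:
  assumes "int p ^ L dvd x"
  shows "v (of_int x) \<le> \<rho> ^ L"
proof (cases "x = 0")
  case False
  moreover have "\<not> is_unit (int p)" using prime_p by (metis not_prime_unit prime_nat_int_transfer)
  ultimately have "L \<le> multiplicity (int p) x"
    using assms by (simp add: power_dvd_iff_le_multiplicity)
  then show ?thesis using v_of_int[OF False] rho by (simp add: power_decreasing)
qed (use v_eq_0[of 0] rho in simp)

lemma coprime_p_pos: "coprime d p \<Longrightarrow> 0 < d"
  using prime_p not_prime_1 by (intro gr0I) auto

lemma v_of_nat_coprime:
  assumes "coprime d p"
  shows "v (of_nat d) = 1"
proof -
  have "\<not> p dvd d"
    using assms prime_p by (metis coprime_common_divisor dvd_refl not_prime_unit)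
  then show ?thesis
    using v_of_nat[of d] coprime_p_pos[OF assms] by (simp add: not_dvd_imp_multiplicity_0)
qed

text \<open>\<open>root_mod \<kappa> d s\<close> is the residue of \<open>\<kappa> / d\<close> modulo \<open>p\<^sup>s\<close>.\<close>
definition root_mod :: "int \<Rightarrow> nat \<Rightarrow> nat \<Rightarrow> nat" where
  "root_mod \<kappa> d s = (LEAST i. int p ^ s dvd \<kappa> - int d * int i)"

context
  fixes \<kappa> :: int and d :: nat
  assumes cop: "coprime d p"
begin

text \<open>As \<open>d\<close> is invertible modulo \<open>p ^ s\<close>, the solutions form a
  single residue class, that of \<open>e * \<kappa>\<close> for an inverse \<open>e\<close> of
  \<open>d\<close>.\<close>

lemma root_mod_dvd: "int p ^ s dvd \<kappa> - int d * int (root_mod \<kappa> d s)"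
  and root_mod_dvd_iff:
    "int p ^ s dvd \<kappa> - int d * int i \<longleftrightarrow> i mod p ^ s = root_mod \<kappa> d s"
  and root_mod_less: "root_mod \<kappa> d s < p ^ s"
proof -
  have P: "0 < p ^ s" using prime_p by (simp add: prime_gt_0_nat)
  have cop': "coprime (int d) (int p ^ s)" using cop by simp
  obtain e where e: "[int d * e = 1] (mod int p ^ s)"
    using cong_solve_coprime_int[OF cop'] by blast
  define i0 where "i0 = nat ((e * \<kappa>) mod int p ^ s)"
  have i0: "int i0 = (e * \<kappa>) mod int p ^ s" using P by (simp add: i0_def)
  have lt: "i0 < p ^ s" using P i0
    by (metis of_nat_0_less_iff of_nat_less_iff of_nat_power pos_mod_bound)
  have iff: "int p ^ s dvd \<kappa> - int d * int i \<longleftrightarrow> i mod p ^ s = i0" for i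
  proof -
    have "[int d * int i0 = \<kappa>] (mod int p ^ s)"
    proof -
      have "[int d * int i0 = int d * (e * \<kappa>)] (mod int p ^ s)"
        unfolding i0 by (intro cong_scalar_left) (simp add: cong_def)
      also have "[int d * (e * \<kappa>) = 1 * \<kappa>] (mod int p ^ s)"
        using cong_scalar_right[OF e, of \<kappa>] by (simp add: mult.assoc)
      finally show ?thesis by simp
    qed
    then have "int p ^ s dvd \<kappa> - int d * int i \<longleftrightarrow> [int d * int i = int d * int i0] (mod int p ^ s)"
      by (metis cong_iff_dvd_diff cong_sym cong_trans)
    also have "\<dots> \<longleftrightarrow> [int i = int i0] (mod int p ^ s)"
      using cop' by (simp add: cong_mult_lcancel)
    also have "\<dots> \<longleftrightarrow> i mod p ^ s = i0"
      using lt cong_int_iff[of i i0 "p ^ s"] by (simp add: cong_def)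
    finally show ?thesis .
  qed
  have "root_mod \<kappa> d s = i0"
    unfolding root_mod_def using lt by (intro Least_equality) (auto simp: iff)
  then show "int p ^ s dvd \<kappa> - int d * int (root_mod \<kappa> d s)"
    "int p ^ s dvd \<kappa> - int d * int i \<longleftrightarrow> i mod p ^ s = root_mod \<kappa> d s"
    "root_mod \<kappa> d s < p ^ s"
    using iff lt by auto
qed

lemma root_mod_mono: "s \<le> t \<Longrightarrow> root_mod \<kappa> d s \<le> root_mod \<kappa> d t"
  unfolding root_mod_def[of \<kappa> d s]
  by (intro Least_le) (meson root_mod_dvd dvd_trans le_imp_power_dvd)

text \<open>Kummer's theorem for \<open>p\<close>-integral rational numbers: the \<open>s\<close> that are counted are the
  positions of the borrows in the \<open>p\<close>-adic subtraction \<open>\<kappa> / d - n\<close>.\<close>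
lemma v_gchoose:
  assumes nz: "\<And>i. i < n \<Longrightarrow> \<kappa> - int d * int i \<noteq> 0"
  obtains S0 where "\<And>S. S \<ge> S0 \<Longrightarrow>
    v ((of_int \<kappa> / of_nat d) gchoose n) = \<rho> ^ card {s\<in>{1..S}. root_mod \<kappa> d s < n mod p ^ s}"
proof -
  have d0: "d \<noteq> 0" using coprime_p_pos[OF cop] by simp
  \<comment> \<open>\<open>S0\<close> is at least every multiplicity that occurs, so cutting the
    levels off at \<open>S \<ge> S0\<close> loses nothing.\<close>
  define S0 where "S0 = (\<Sum>i<n. multiplicity (int p) (\<kappa> - int d * int i)) + (\<Sum>i<n. multiplicity (int p) (int (Suc i)))"
  have "v ((of_int \<kappa> / of_nat d) gchoose n) = \<rho> ^ card {s\<in>{1..S}. root_mod \<kappa> d s < n mod p ^ s}"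
    if S: "S \<ge> S0" for S
  proof -
    have "(of_int \<kappa> / of_nat d) gchoose n = (\<Prod>i<n. of_int \<kappa> / of_nat d - of_nat i) / (fact n :: 'a)"
      by (simp add: gbinomial_prod_rev atLeast0LessThan)
    also have "(\<Prod>i<n. of_int \<kappa> / of_nat d - of_nat i :: 'a) =
        (\<Prod>i<n. of_int (\<kappa> - int d * int i) / of_nat d)"
      using d0 by (intro prod.cong) (auto simp: field_simps)
    also have "v (\<dots> / fact n) = (\<Prod>i<n. v (of_int (\<kappa> - int d * int i))) / (\<Prod>i<n. v (of_int (int (Suc i))))"
      unfolding fact_prod_Suc
      by (simp add: v_divide v_prod v_of_nat_coprime[OF cop] atLeast0LessThan)
    also have "(\<Prod>i<n. v (of_int (\<kappa> - int d * int i))) = \<rho> ^ (\<Sum>i<n. multiplicity (int p) (\<kappa> - int d * int i))"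
      unfolding power_sum using nz by (intro prod.cong refl v_of_int) simp
    also have "(\<Sum>i<n. multiplicity (int p) (\<kappa> - int d * int i)) =
        (\<Sum>i<n. \<Sum>s\<in>{1..S}. of_bool (int p ^ s dvd \<kappa> - int d * int i))"
    proof (intro sum.cong refl multiplicity_eq_card_dvd prime_p nz)
      fix i assume "i \<in> {..<n}"
      then show "multiplicity (int p) (\<kappa> - int d * int i) \<le> S"
        using member_le_sum[of i "{..<n}" "\<lambda>i. multiplicity (int p) (\<kappa> - int d * int i)"] S
        unfolding S0_def by force
    qed auto
    \<comment> \<open>At level \<open>s\<close> the numerator contributes
      \<open>n div p ^ s\<close>, plus one for a borrow, and the factorial contributes
      \<open>n div p ^ s\<close>; only the borrows survive in the quotient.\<close>
    also have "\<dots> = (\<Sum>s\<in>{1..S}. \<Sum>i<n. of_bool (i mod p ^ s = root_mod \<kappa> d s))"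
      by (subst sum.swap) (simp add: root_mod_dvd_iff)
    also have "\<dots> = (\<Sum>s\<in>{1..S}. n div p ^ s + of_bool (root_mod \<kappa> d s < n mod p ^ s))"
      by (intro sum.cong refl sum_mod_eq root_mod_less)
    also have "\<dots> = (\<Sum>s\<in>{1..S}. n div p ^ s) + card {s\<in>{1..S}. root_mod \<kappa> d s < n mod p ^ s}"
      by (simp add: sum.distrib sum.If_cases of_bool_def Int_def)
    also have "(\<Prod>i<n. v (of_int (int (Suc i)))) = \<rho> ^ (\<Sum>i<n. multiplicity (int p) (int (Suc i)))"
      unfolding power_sum by (intro prod.cong refl v_of_int) simp
    also have "(\<Sum>i<n. multiplicity (int p) (int (Suc i))) =
        (\<Sum>i<n. \<Sum>s\<in>{1..S}. of_bool (int p ^ s dvd int (Suc i)))"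
    proof (intro sum.cong refl multiplicity_eq_card_dvd prime_p)
      fix i assume "i \<in> {..<n}"
      then show "multiplicity (int p) (int (Suc i)) \<le> S"
        using member_le_sum[of i "{..<n}" "\<lambda>i. multiplicity (int p) (int (Suc i))"] S
        unfolding S0_def by force
    qed auto
    also have "\<dots> = (\<Sum>s\<in>{1..S}. \<Sum>i<n. of_bool (p ^ s dvd Suc i))"
      by (subst sum.swap) (simp only: of_nat_power[symmetric] of_nat_dvd_iff)
    also have "\<dots> = (\<Sum>s\<in>{1..S}. n div p ^ s)"
      using prime_p by (intro sum.cong refl sum_dvd_Suc) (simp add: prime_gt_0_nat)
    finally show ?thesis using rho by (simp add: power_add)
  qed
  then show ?thesis using that by blast
qed

lemma v_gchoose_le_1: "v ((of_int \<kappa> / of_nat d) gchoose n) \<le> 1"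
proof (cases "\<exists>i<n. \<kappa> - int d * int i = 0")
  case True
  then obtain i where i: "i < n" "\<kappa> = int d * int i" by auto
  have "d \<noteq> 0" using coprime_p_pos[OF cop] by simp
  then have "(of_int \<kappa> / of_nat d :: 'a) = of_nat i" using i by simp
  then have "(of_int \<kappa> / of_nat d :: 'a) gchoose n = 0"
    using i by (simp add: binomial_gbinomial[symmetric])
  then show ?thesis using v_eq_0[of 0] by simp
next
  case False
  then obtain S0 where "v ((of_int \<kappa> / of_nat d) gchoose n) =
      \<rho> ^ card {s\<in>{1..S0}. root_mod \<kappa> d s < n mod p ^ s}"
    using v_gchoose[of n] by blast
  then show ?thesis using rho by (simp add: power_le_one)
qed

end

text \<open>The numerator factors are \<open>x - (i + 1)\<close> with \<open>i + 1 < p ^ L\<close>,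
  so \<open>i + 1\<close> dominates \<open>x\<close> in absolute value, and the product cancels
  against the factorial.\<close>

lemma v_gchoose_pred:
  assumes "v x \<le> \<rho> ^ L"
  shows "v ((x - 1) gchoose (p ^ L - 1)) = 1"
proof -
  have "v (x - 1 - of_nat i) = v (of_nat (Suc i))" if "i < p ^ L - 1" for i
  proof -
    have "\<not> p ^ L dvd Suc i" using that by (auto dest!: dvd_imp_le)
    then have "\<not> int p ^ L dvd int (Suc i)" by (metis of_nat_dvd_iff of_nat_power)
    then have "multiplicity (int p) (int (Suc i)) < L"
      by (meson multiplicity_dvd' not_less)
    then have "\<rho> ^ L < v (of_nat (Suc i))"
      using v_of_nat[of "Suc i"] rho by (simp add: power_strict_decreasing)
    then have "v (- of_nat (Suc i) + x) = v (- of_nat (Suc i))"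
      using assms v_minus[of "of_nat (Suc i)"] by (intro v_add_eq) simp
    then show ?thesis using v_minus[of "of_nat (Suc i)"] by (simp add: algebra_simps)
  qed
  then have "(\<Prod>i<p ^ L - 1. v (x - 1 - of_nat i)) = (\<Prod>i<p ^ L - 1. v (of_nat (Suc i)))"
    by (intro prod.cong) auto
  moreover have "(\<Prod>i<p ^ L - 1. v (of_nat (Suc i))) \<noteq> 0"
    using v_eq_0 by (simp del: of_nat_Suc)
  ultimately show ?thesis
    unfolding gbinomial_prod_rev fact_prod_Suc
    by (simp add: v_divide v_prod atLeast0LessThan del: of_nat_Suc)
qed

text \<open>With \<open>a = \<kappa> / d\<close> and \<open>b = c / (e d)\<close>, the levels \<open>s\<close> at which there is no borrow in
  \<open>a - b\<close>, so that the binomial coefficient of \<open>a\<close> over \<open>m \<equiv> b (mod p\<^sup>L)\<close> misses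
  the divisibility by \<open>p\<^sup>L\<close> by one factor \<open>p\<close> for each of them.\<close>
definition no_borrow :: "int \<Rightarrow> int \<Rightarrow> nat \<Rightarrow> nat \<Rightarrow> nat set" where
  "no_borrow c \<kappa> d e = {s. root_mod c (e * d) s \<le> root_mod \<kappa> d s}"

section \<open>The dominant contribution to a coefficient\<close>

context
  fixes c \<kappa> :: int and d e :: nat
  assumes cop: "coprime d p" and cope: "coprime e p"
    and nz: "\<And>i. \<kappa> - int d * int i \<noteq> 0"
begin

text \<open>It is applied with \<open>c = d + q * k\<close> and \<open>e = q - 1\<close>, where the
  upper arguments become \<open>mu q d k m - 1\<close> and \<open>\<epsilon>\<close> carries the
  signs. \<open>N\<close> is chosen so that the term of \<open>m0\<close> has denominator
  \<open>p ^ L\<close>; this term strictly dominates.\<close>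

lemma v_sum_gchoose:
  fixes \<epsilon> :: "nat \<Rightarrow> 'a"
  assumes L: "L \<in> no_borrow c \<kappa> d e" "1 \<le> L"
    and m0: "m0 = root_mod c (e * d) L" and N: "N = e * m0 + p ^ L"
    and eps: "\<And>m. v (\<epsilon> m) = 1"
  shows "v (\<Sum>m | e * m < N. \<epsilon> m * ((of_int \<kappa> / of_nat d) gchoose m) *
      (((of_int (c - int (e * d * m)) / of_nat d - 1) gchoose (N - e * m - 1)) / of_nat (N - e * m)))
    = inverse (\<rho> ^ card (no_borrow c \<kappa> d e \<inter> {1..L}))"
    (is "v (\<Sum>m | _. ?t m) = _")
proof -
  have cop': "coprime (e * d) p" using cop cope by simp
  have e0: "0 < e" and d0: "0 < d" using coprime_p_pos cop cope by auto
  have m0_less: "m0 < p ^ L" unfolding m0 by (rule root_mod_less[OF cop'])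
  have m0_mod: "m0 mod p ^ s = root_mod c (e * d) s" if "s \<le> L" for s
    using root_mod_dvd[OF cop', of s] root_mod_dvd[OF cop', of L c] root_mod_dvd_iff[OF cop', of s c m0]
      that m0 by (meson dvd_trans le_imp_power_dvd)
  define g where "g = card (no_borrow c \<kappa> d e \<inter> {1..L})"
  have g_pos: "0 < g" unfolding g_def using L by (auto simp: card_gt_0_iff)
  have fin: "finite {m. e * m < N}"
    by (rule finite_subset[of _ "{..<N}"]) (use e0 in \<open>auto intro: le_less_trans[rotated]\<close>)
  have borrow_card: "card {s\<in>{1..l}. root_mod \<kappa> d s < root_mod c (e * d) s} + card (no_borrow c \<kappa> d e \<inter> {1..l}) = l" for l
  proof -
    have "card {s\<in>{1..l}. root_mod \<kappa> d s < root_mod c (e * d) s} + card (no_borrow c \<kappa> d e \<inter> {1..l})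
      = card ({s\<in>{1..l}. root_mod \<kappa> d s < root_mod c (e * d) s} \<union> (no_borrow c \<kappa> d e \<inter> {1..l}))"
      by (intro card_Un_disjoint[symmetric]) (auto simp: no_borrow_def)
    also have "{s\<in>{1..l}. root_mod \<kappa> d s < root_mod c (e * d) s} \<union> (no_borrow c \<kappa> d e \<inter> {1..l}) = {1..l}"
      by (auto simp: no_borrow_def)
    finally show ?thesis by simp
  qed
  have main: "v (?t m0) = inverse (\<rho> ^ g)"
  proof -
    obtain S0 where S0: "\<And>S. S \<ge> S0 \<Longrightarrow> v ((of_int \<kappa> / of_nat d) gchoose m0) =
        \<rho> ^ card {s\<in>{1..S}. root_mod \<kappa> d s < m0 mod p ^ s}"
      using v_gchoose[OF cop, of m0 \<kappa>] nz by blast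
    have "{s\<in>{1..max S0 L}. root_mod \<kappa> d s < m0 mod p ^ s} =
        {s\<in>{1..L}. root_mod \<kappa> d s < root_mod c (e * d) s}"
    proof -
      \<comment> \<open>Beyond \<open>L\<close> there are no borrows: \<open>m0\<close> is at most
        the residue of \<open>\<kappa> / d\<close> modulo \<open>p ^ L\<close>, and residues only
        grow with the level.\<close>
      have False if "root_mod \<kappa> d s < m0 mod p ^ s" "\<not> s \<le> L" for s
      proof -
        have "m0 \<le> root_mod \<kappa> d L" using L by (simp add: no_borrow_def m0)
        also have "\<dots> \<le> root_mod \<kappa> d s" using that by (intro root_mod_mono[OF cop]) simp
        finally show False using that by (meson leD le_trans mod_less_eq_dividend)
      qed
      then have "root_mod \<kappa> d s < m0 mod p ^ s \<longleftrightarrow>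
          s \<le> L \<and> root_mod \<kappa> d s < root_mod c (e * d) s" for s
        using m0_mod[of s] by fastforce
      then show ?thesis by auto
    qed
    moreover have "card {s\<in>{1..L}. root_mod \<kappa> d s < root_mod c (e * d) s} = L - g"
      using borrow_card[of L] unfolding g_def by linarith
    ultimately have "v ((of_int \<kappa> / of_nat d) gchoose m0) = \<rho> ^ (L - g)"
      using S0[of "max S0 L"] by simp
    moreover have "v ((of_int (c - int (e * d * m0)) / of_nat d - 1) gchoose (p ^ L - 1)) = 1"
    proof (rule v_gchoose_pred)
      have "int p ^ L dvd c - int (e * d) * int m0" unfolding m0 by (rule root_mod_dvd[OF cop'])
      then have "v (of_int (c - int (e * d * m0))) \<le> \<rho> ^ L"
        by (intro v_of_int_dvd) simp
      then show "v (of_int (c - int (e * d * m0)) / of_nat d) \<le> \<rho> ^ L"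
        unfolding v_divide v_of_nat_coprime[OF cop] by simp
    qed
    moreover have "v (of_nat (p ^ L)) = \<rho> ^ L"
      using v_of_nat[of "p ^ L"] prime_p by (simp add: multiplicity_same_power)
    moreover have "g \<le> L" using borrow_card[of L] by (simp add: g_def)
    ultimately have "v (?t m0) = \<rho> ^ (L - g) / \<rho> ^ L"
      using eps N by (simp add: v_mult v_divide)
    then show ?thesis using rho \<open>g \<le> L\<close> by (simp add: power_diff field_simps)
  qed
  \<comment> \<open>If \<open>l\<close> is the valuation of the denominator \<open>r\<close>, then
    \<open>m\<close> agrees with \<open>m0\<close> modulo \<open>p ^ l\<close> and has the same
    borrows up to \<open>l\<close>. The bound is thus governed by the no-borrow levels up to
    \<open>l\<close>, and \<open>l < L\<close> leaves out at least the level
    \<open>L\<close>.\<close>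
  have other: "v (?t m) \<le> inverse (\<rho> ^ (g - 1))" if m: "e * m < N" "m \<noteq> m0" for m
  proof -
    define r where "r = N - e * m"
    have r0: "r \<noteq> 0" using m by (simp add: r_def)
    define l where "l = multiplicity (int p) (int r)"
    have rr: "int r = int p ^ L + int e * (int m0 - int m)"
      using m by (simp add: r_def N of_nat_diff algebra_simps)
    have cop_e: "coprime (int p ^ s) (int e)" for s
      using cope by (simp add: coprime_commute)
    have cong_m: "m mod p ^ s = m0 mod p ^ s" if "s \<le> L" "int p ^ s dvd int r" for s
    proof -
      have "int p ^ s dvd int e * (int m0 - int m)"
        using that rr by (metis dvd_add_right_iff le_imp_power_dvd)
      then have "int p ^ s dvd int m0 - int m"
        using cop_e by (metis coprime_dvd_mult_right_iff)
      then show ?thesis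
        by (metis mod_eq_dvd_iff of_nat_eq_iff of_nat_mod of_nat_power)
    qed
    \<comment> \<open>Otherwise \<open>m\<close> is congruent to \<open>m0 < p ^ L\<close> but
      different from it, hence at least \<open>m0 + p ^ L\<close>, and \<open>e * m\<close> reaches
      \<open>N\<close>.\<close>
    have l_less: "l < L"
    proof (rule ccontr)
      assume "\<not> l < L"
      then have "int p ^ L dvd int r" unfolding l_def by (intro multiplicity_dvd') simp
      then have "m mod p ^ L = m0" using cong_m[of L] m0_less by simp
      then have mm: "m = p ^ L * (m div p ^ L) + m0" by (metis div_mult_mod_eq mult.commute)
      then have "m div p ^ L \<noteq> 0" using m by (intro notI) simp
      then have "p ^ L + m0 \<le> m" using mm by (metis add_le_mono1 mult_le_mono2 mult.right_neutral less_one not_less)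
      then have "e * (p ^ L + m0) \<le> e * m" by simp
      then have "e * p ^ L < p ^ L" using m N unfolding distrib_left by linarith
      moreover have "p ^ L \<le> e * p ^ L" using e0 by simp
      ultimately show False by linarith
    qed
    have mod_m: "m mod p ^ s = root_mod c (e * d) s" if "s \<le> l" for s
      using cong_m[of s] m0_mod[of s] that l_less unfolding l_def by (simp add: multiplicity_dvd')
    obtain S0 where S0: "\<And>S. S \<ge> S0 \<Longrightarrow> v ((of_int \<kappa> / of_nat d) gchoose m) =
        \<rho> ^ card {s\<in>{1..S}. root_mod \<kappa> d s < m mod p ^ s}"
      using v_gchoose[OF cop, of m \<kappa>] nz by blast
    have "card {s\<in>{1..l}. root_mod \<kappa> d s < root_mod c (e * d) s}
        \<le> card {s\<in>{1..max S0 l}. root_mod \<kappa> d s < m mod p ^ s}"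
      by (intro card_mono) (auto simp: mod_m)
    then have 1: "v ((of_int \<kappa> / of_nat d) gchoose m) \<le> \<rho> ^ (l - card (no_borrow c \<kappa> d e \<inter> {1..l}))"
      using S0[of "max S0 l"] borrow_card[of l] rho by (simp add: power_decreasing)
    have "of_int (c - int (e * d * m)) / of_nat d - 1 =
        (of_int (c - int (e * d * m) - int d) / of_nat d :: 'a)"
      using d0 by (simp add: field_simps)
    then have 2: "v ((of_int (c - int (e * d * m)) / of_nat d - 1) gchoose (r - 1)) \<le> 1"
      using v_gchoose_le_1[OF cop] by metis
    have 3: "v (of_nat r) = \<rho> ^ l" using v_of_nat[OF r0] by (simp add: l_def)
    have "v (?t m) = v ((of_int \<kappa> / of_nat d) gchoose m) *
        v ((of_int (c - int (e * d * m)) / of_nat d - 1) gchoose (r - 1)) / \<rho> ^ l"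
      by (simp add: v_mult v_divide eps 3[symmetric] r_def[symmetric] del: of_nat_Suc)
    also have "\<dots> \<le> \<rho> ^ (l - card (no_borrow c \<kappa> d e \<inter> {1..l})) * 1 / \<rho> ^ l"
      using 1 2 rho v_nonneg by (intro divide_right_mono mult_mono) auto
    also have "\<dots> = inverse (\<rho> ^ card (no_borrow c \<kappa> d e \<inter> {1..l}))"
      using rho borrow_card[of l] by (simp add: power_diff field_simps)
    also have "\<dots> \<le> inverse (\<rho> ^ (g - 1))"
    proof -
      have "L \<in> no_borrow c \<kappa> d e \<inter> {1..L}" "L \<notin> no_borrow c \<kappa> d e \<inter> {1..l}" using L l_less by auto
      moreover have "no_borrow c \<kappa> d e \<inter> {1..l} \<subseteq> no_borrow c \<kappa> d e \<inter> {1..L}" using l_less by auto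
      ultimately have "no_borrow c \<kappa> d e \<inter> {1..l} \<subset> no_borrow c \<kappa> d e \<inter> {1..L}" by blast
      then have "card (no_borrow c \<kappa> d e \<inter> {1..l}) < g" unfolding g_def by (intro psubset_card_mono) auto
      then show ?thesis using rho by (intro le_imp_inverse_le power_decreasing) auto
    qed
    finally show ?thesis .
  qed
  have "v (\<Sum>m\<in>{m. e * m < N} - {m0}. ?t m) \<le> inverse (\<rho> ^ (g - 1))"
    using other rho by (intro v_sum_le) auto
  also have "\<dots> < inverse (\<rho> ^ g)"
    using rho g_pos by (intro less_imp_inverse_less power_strict_decreasing) auto
  finally have "v (?t m0 + (\<Sum>m\<in>{m. e * m < N} - {m0}. ?t m)) = v (?t m0)"
    using main by (intro v_add_eq) simp
  moreover have "(\<Sum>m | e * m < N. ?t m) = ?t m0 + (\<Sum>m\<in>{m. e * m < N} - {m0}. ?t m)"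
    using fin N prime_p by (intro sum.remove) (auto simp: prime_gt_0_nat)
  ultimately show ?thesis using main g_def by simp
qed

end

end

subsection \<open>Coefficients of the bracket sum\<close>

text \<open>The series is \<open>fps_binomial\<close> with \<open>- fps_X\<close> substituted, so
  the exponent law carries over.\<close>

lemma binom_series_mult: "binom_series (a + b) = binom_series a * binom_series b"
proof -
  have *: "(- fps_X) ^ i = fps_const ((- 1) ^ i) * (fps_X :: 'a fps) ^ i" for i
    by (metis fps_const_1_eq_1 fps_const_neg fps_const_power power_minus)
  have "fps_nth ((- fps_X) ^ i :: 'a fps) n = (if i = n then (- 1) ^ n else 0)" for i n
    unfolding * by simp
  then have "binom_series c = fps_binomial c oo (- fps_X)" for c :: 'a
    by (simp add: fps_eq_iff binom_series_def fps_compose_nth if_distrib[of "\<lambda>x. _ * x"] cong: if_cong)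
  then show ?thesis by (simp add: fps_binomial_add_mult fps_compose_mult_distrib)
qed

lemma binom_series_0: "binom_series 0 = 1"
  by (simp add: fps_eq_iff binom_series_def gbinomial_0_left)

text \<open>The absorption identity cancels \<open>\<mu>\<close> and leaves the denominators
  \<open>n + 1\<close>, which are the source of the unboundedness.\<close>

lemma binom_series_quotient:
  fixes \<mu> :: "'a::field_char_0"
  assumes "\<mu> \<noteq> 0"
  shows "(binom_series \<mu> - 1) / (fps_const \<mu> * fps_X) =
    Abs_fps (\<lambda>n. (- 1) ^ Suc n * ((\<mu> - 1) gchoose n) / of_nat (Suc n))" (is "_ = ?Q")
proof -
  have "binom_series \<mu> - 1 = (fps_const \<mu> * fps_X) * ?Q"
  proof (rule fps_ext)
    fix n
    show "fps_nth (binom_series \<mu> - 1) n = fps_nth ((fps_const \<mu> * fps_X) * ?Q) n"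
    proof (cases n)
      case (Suc k)
      have "\<mu> gchoose Suc k = \<mu> * ((\<mu> - 1) gchoose k) / of_nat (Suc k)"
        using gbinomial_absorption[of k \<mu>] by (simp add: field_simps del: of_nat_Suc)
      then show ?thesis using Suc by (simp add: binom_series_def mult.assoc)
    qed (simp add: binom_series_def mult.assoc)
  qed
  then show ?thesis using assms by simp
qed

text \<open>The partial sums with more than \<open>n\<close> terms all have the same coefficient at
  \<open>n\<close>.\<close>

lemma suminf_fps_nth:
  fixes f :: "nat \<Rightarrow> 'a::comm_ring_1 fps"
  assumes *: "\<And>m n. n < m \<Longrightarrow> fps_nth (f m) n = 0"
  shows "fps_nth (suminf f) n = (\<Sum>m\<le>n. fps_nth (f m) n)"
proof -
  have "f sums Abs_fps (\<lambda>n. \<Sum>m\<le>n. fps_nth (f m) n)"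
    unfolding sums_def
  proof (rule tendsto_fpsI)
    fix n
    have "fps_nth (\<Sum>m<M. f m) n = (\<Sum>m\<le>n. fps_nth (f m) n)" if "n < M" for M
      unfolding fps_sum_nth using that * by (intro sum.mono_neutral_right) auto
    then show "\<forall>\<^sub>F M in sequentially. fps_nth (\<Sum>m<M. f m) n = fps_nth (Abs_fps (\<lambda>n. \<Sum>m\<le>n. fps_nth (f m) n)) n"
      by (auto intro!: eventually_mono[OF eventually_gt_at_top[of n]])
  qed
  then show ?thesis by (simp add: sums_iff)
qed

definition bracket_sum :: "nat \<Rightarrow> nat \<Rightarrow> nat \<Rightarrow> 'a::field_char_0 fps" where
  "bracket_sum q d k = (\<Sum>m. (- 1) ^ m * fps_const ((of_nat k / of_nat d) gchoose m) * fps_X ^ ((q - 1) * m) *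
        ((binom_series (mu q d k m) - 1) / (fps_const (mu q d k m) * fps_X)))"

text \<open>The factors with exponents \<open>- k / d\<close> and \<open>k / d\<close> are inverse
  to each other. In this form a bound for \<open>zeta\<close> passes to
  \<open>bracket_sum\<close>.\<close>

lemma bracket_sum_eq_zeta_mult:
  assumes "2 \<le> q"
  shows "fps_const (\<pi> :: 'a::field_char_0) * bracket_sum q d k =
    zeta \<pi> q d k * (binom_series (of_nat k / of_nat d) oo fps_X ^ (q - 1))"
proof -
  let ?a = "of_nat k / of_nat d"
  have "binom_series (- ?a) * binom_series ?a = (1 :: 'a fps)"
    using binom_series_mult[of "- ?a" ?a] by (simp add: binom_series_0)
  moreover have "fps_nth (fps_X ^ (q - 1) :: 'a fps) 0 = 0"
    using assms by simp
  ultimately have "(binom_series (- ?a) oo fps_X ^ (q - 1)) * (binom_series ?a oo fps_X ^ (q - 1)) = (1 :: 'a fps)"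
    by (metis fps_compose_mult_distrib fps_compose_1)
  then show ?thesis unfolding zeta_def bracket_sum_def[symmetric] by (simp add: algebra_simps)
qed

text \<open>A zero would give \<open>d dvd q * k\<close>, hence \<open>d dvd k\<close> because a
  divisor of \<open>q + 1\<close> is coprime to \<open>q\<close>; this contradicts
  \<open>1 \<le> k < d\<close>.\<close>

lemma mu_neq_0:
  assumes "2 \<le> q" "d dvd q + 1" "1 \<le> k" "k < d"
  shows "mu q d k m \<noteq> (0 :: 'a::field_char_0)"
proof
  assume "mu q d k m = (0 :: 'a)"
  then have "of_nat (d + q * k) = (of_nat ((q - 1) * m * d) :: 'a)"
    using assms by (simp add: mu_def field_simps of_nat_diff)
  then have "d + q * k = (q - 1) * m * d" by (simp only: of_nat_eq_iff)
  then have "d dvd q * k" by (metis dvd_add_right_iff dvd_refl dvd_triv_right)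
  moreover have "coprime d q"
    using assms by (metis coprime_add_one_right coprime_commute coprime_divisors dvd_refl)
  ultimately have "d dvd k" by (simp add: coprime_dvd_mult_right_iff)
  then show False using assms by (auto dest: dvd_imp_le)
qed

text \<open>The index \<open>N - 1\<close> absorbs the shift in the bracket, so that the
  denominators are \<open>N - (q - 1) * m\<close>.\<close>

lemma bracket_sum_nth:
  assumes "2 \<le> q" "d dvd q + 1" "1 \<le> k" "k < d" "0 < N"
  shows "fps_nth (bracket_sum q d k :: 'a::field_char_0 fps) (N - 1) =
    (\<Sum>m | (q - 1) * m < N. (- 1) ^ (m + (N - (q - 1) * m)) * ((of_nat k / of_nat d) gchoose m) *
      (((mu q d k m - 1) gchoose (N - (q - 1) * m - 1)) / of_nat (N - (q - 1) * m)))"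
proof -
  define f :: "nat \<Rightarrow> 'a fps" where
    "f m = (- 1) ^ m * fps_const ((of_nat k / of_nat d) gchoose m) * fps_X ^ ((q - 1) * m) *
        ((binom_series (mu q d k m) - 1) / (fps_const (mu q d k m) * fps_X))" for m
  have f_nth: "fps_nth (f m) n = (if n < (q - 1) * m then 0 else
     (- 1) ^ m * ((of_nat k / of_nat d) gchoose m) * ((- 1) ^ Suc (n - (q - 1) * m) *
      ((mu q d k m - 1) gchoose (n - (q - 1) * m)) / of_nat (Suc (n - (q - 1) * m))))" for m n
  proof -
    have "f m = fps_const ((- 1) ^ m * ((of_nat k / of_nat d) gchoose m)) * (fps_X ^ ((q - 1) * m) *
       Abs_fps (\<lambda>n. (- 1) ^ Suc n * ((mu q d k m - 1) gchoose n) / of_nat (Suc n)))"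
      unfolding f_def binom_series_quotient[OF mu_neq_0[OF assms(1-4)]]
      by (simp add: mult.assoc flip: fps_const_power fps_const_mult fps_const_neg)
    then show ?thesis by (simp add: fps_X_power_mult_nth)
  qed
  have q1: "1 \<le> q - 1" using assms(1) by simp
  have ge: "m \<le> (q - 1) * m" for m
    using mult_le_mono1[OF q1, of m] by (simp only: mult_1)
  have "fps_nth (f m) n = 0" if "n < m" for m n
  proof -
    have "n < (q - 1) * m" using that ge[of m] by (rule less_le_trans)
    then show ?thesis unfolding f_nth by (rule if_P)
  qed
  then have "fps_nth (bracket_sum q d k) (N - 1) = (\<Sum>m\<le>N - 1. fps_nth (f m) (N - 1))"
    unfolding bracket_sum_def f_def[symmetric] by (intro suminf_fps_nth) auto
  also have "\<dots> = (\<Sum>m | (q - 1) * m < N. fps_nth (f m) (N - 1))"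
  proof (intro sum.mono_neutral_right)
    have "m \<le> N - 1" if "(q - 1) * m < N" for m using that ge[of m] by linarith
    then show "{m. (q - 1) * m < N} \<subseteq> {..N - 1}" by auto
  qed (use assms(5) in \<open>auto simp: f_nth\<close>)
  also have "\<dots> = (\<Sum>m | (q - 1) * m < N. (- 1) ^ (m + (N - (q - 1) * m)) * ((of_nat k / of_nat d) gchoose m) *
      (((mu q d k m - 1) gchoose (N - (q - 1) * m - 1)) / of_nat (N - (q - 1) * m)))"
  proof (intro sum.cong refl)
    fix m assume "m \<in> {m. (q - 1) * m < N}"
    then obtain r where r: "N - (q - 1) * m = Suc r" "N - 1 - (q - 1) * m = r" "\<not> N - 1 < (q - 1) * m"
      by (cases "N - (q - 1) * m") auto
    show "fps_nth (f m) (N - 1) = (- 1) ^ (m + (N - (q - 1) * m)) * ((of_nat k / of_nat d) gchoose m) *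
      (((mu q d k m - 1) gchoose (N - (q - 1) * m - 1)) / of_nat (N - (q - 1) * m))"
      unfolding f_nth if_not_P[OF r(3)] r(1,2) by (simp add: power_add del: of_nat_Suc)
  qed
  finally show ?thesis .
qed


subsection \<open>The residue field\<close>

text \<open>Presents the residue field as a quotient of additive groups, so that group theory can
  determine its order.\<close>

lemma val_ring_residue_classes:
  fixes v :: "'a::field \<Rightarrow> real"
  assumes "nonarch_abs v" "is_subfield F"
  defines "G \<equiv> \<lparr>carrier = val_ring v F, monoid.mult = (+), one = 0\<rparr>"
  shows "max_ideal v F \<lhd> G" "carrier (G Mod max_ideal v F) = residue_field v F"
proof -
  have v: "\<And>x. 0 \<le> v x" "\<And>x. v x = 0 \<longleftrightarrow> x = 0" "\<And>x y. v (x * y) = v x * v y"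
    "\<And>x y. v (x + y) \<le> max (v x) (v y)"
    using assms by (auto simp: nonarch_abs_def)
  note minus = nonarch_abs_minus[OF assms(1)]
  have F: "0 \<in> F" "\<And>x y. x \<in> F \<Longrightarrow> y \<in> F \<Longrightarrow> x - y \<in> F"
    using assms by (auto simp: is_subfield_def)
  have Fm: "- x \<in> F" if "x \<in> F" for x using F(2)[OF F(1) that] by simp
  have Fp: "x + y \<in> F" if "x \<in> F" "y \<in> F" for x y using F(2)[OF that(1) Fm[OF that(2)]] by simp
  have v0: "v 0 = 0" using v(2) by simp
  have vle: "v (x + y) \<le> 1" if "v x \<le> 1" "v y \<le> 1" for x y using v(4)[of x y] that by simp
  have vless: "v (x + y) < 1" if "v x < 1" "v y < 1" for x y using v(4)[of x y] that by simp
  interpret G: comm_group "G"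
  proof (rule comm_groupI)
    show "\<exists>y\<in>carrier G. y \<otimes>\<^bsub>G\<^esub> x = \<one>\<^bsub>G\<^esub>" if "x \<in> carrier G" for x
      using that by (intro bexI[of _ "- x"]) (auto simp: G_def val_ring_def minus Fm)
  qed (auto simp: G_def val_ring_def F Fp v0 vle add.assoc add.commute)
  have inv: "inv\<^bsub>G\<^esub> x = - x" if "x \<in> val_ring v F" for x
    using that by (intro G.inv_equality) (auto simp: G_def val_ring_def minus Fm)
  have "subgroup (max_ideal v F) (G)"
  proof (rule G.subgroupI)
    show "inv\<^bsub>G\<^esub> x \<in> max_ideal v F" if "x \<in> max_ideal v F" for x
      using that inv[of x] by (auto simp: max_ideal_def val_ring_def minus Fm)
    have "0 \<in> max_ideal v F" using F v0 by (simp add: max_ideal_def)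
    then show "max_ideal v F \<noteq> {}" by auto
  qed (auto simp: G_def max_ideal_def val_ring_def Fp vless)
  then show "max_ideal v F \<lhd> G" by (rule G.subgroup_imp_normal)
  have "max_ideal v F #>\<^bsub>G\<^esub> x =
      {(x, y). x \<in> val_ring v F \<and> y \<in> val_ring v F \<and> x - y \<in> max_ideal v F} `` {x}"
    if x: "x \<in> val_ring v F" for x
  proof (intro Set.set_eqI iffI)
    fix y assume "y \<in> max_ideal v F #>\<^bsub>G\<^esub> x"
    then obtain h where h: "h \<in> max_ideal v F" "y = h + x" by (auto simp: r_coset_def G_def)
    then show "y \<in> {(x, y). x \<in> val_ring v F \<and> y \<in> val_ring v F \<and> x - y \<in> max_ideal v F} `` {x}"
      using x by (auto simp: max_ideal_def val_ring_def minus Fm Fp vle)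
  next
    fix y assume y: "y \<in> {(x, y). x \<in> val_ring v F \<and> y \<in> val_ring v F \<and> x - y \<in> max_ideal v F} `` {x}"
    then have "y - x \<in> max_ideal v F" using minus[of "x - y"] Fm[of "x - y"] by (auto simp: max_ideal_def)
    then show "y \<in> max_ideal v F #>\<^bsub>G\<^esub> x"
      by (auto simp: r_coset_def G_def intro!: bexI[of _ "y - x"])
  qed
  then show "carrier (G Mod max_ideal v F) = residue_field v F"
    unfolding carrier_FactGroup residue_field_def quotient_def by (auto simp: G_def)
qed

text \<open>Cauchy's theorem by way of Sylow: a subgroup of order \<open>r\<close> has a nontrivial
  element, whose order divides both \<open>r\<close> and \<open>n\<close> and so equals
  \<open>r\<close>.\<close>

lemma (in group) prime_dvd_exponent_of_prime_dvd_order: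
  assumes "finite (carrier G)" "prime r" "r dvd order G" "\<And>x. x \<in> carrier G \<Longrightarrow> x [^] n = \<one>"
  shows "r dvd n"
proof -
  obtain m where "order G = r ^ 1 * m" using assms(3) by auto
  then obtain K where K: "subgroup K G" "card K = r"
    using sylow_thm[OF assms(2) is_group _ assms(1)] by fastforce
  have K_sub: "K \<subseteq> carrier G" "\<one> \<in> K" using K(1) subgroup.subset subgroup.one_closed by auto
  have "2 \<le> card K" using K(2) prime_ge_2_nat[OF assms(2)] by simp
  then have "K \<noteq> {\<one>}" by auto
  then obtain x where x: "x \<in> K" "x \<noteq> \<one>" using K_sub by auto
  interpret K: group "G\<lparr>carrier := K\<rparr>" by (rule subgroup_imp_group[OF K(1)])
  have "x [^]\<^bsub>G\<lparr>carrier := K\<rparr>\<^esub> order (G\<lparr>carrier := K\<rparr>) = \<one>"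
    using x K.pow_order_eq_1[of x] by simp
  then have "x [^] r = \<one>" using K(2) nat_pow_consistent[of x _ K] by (simp add: order_def)
  then have "ord x dvd r" using x K_sub by (simp add: pow_eq_id subset_iff)
  moreover have "ord x dvd n" using x K_sub assms(4)[of x] pow_eq_id by auto
  moreover have "ord x \<noteq> 1" using x K_sub ord_eq_1 by auto
  ultimately show ?thesis using assms(2) by (metis prime_nat_iff)
qed

lemma eq_prime_power_nat:
  fixes n p :: nat
  assumes "n \<noteq> 0" "prime p" "\<And>r. prime r \<Longrightarrow> r dvd n \<Longrightarrow> r = p"
  shows "\<exists>f. n = p ^ f"
proof -
  obtain y where y: "n = p ^ multiplicity p n * y" "\<not> p dvd y"
    using multiplicity_decompose'[of n p] assms not_prime_unit by blast
  have "y = 1"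
  proof (rule ccontr)
    assume "y \<noteq> 1"
    then obtain r where "prime r" "r dvd y" using prime_factor_nat by blast
    then show False using assms(3)[of r] y by (metis dvd_mult)
  qed
  then show ?thesis using y by auto
qed

text \<open>Since \<open>v (of_nat p) < 1\<close>, multiplication by \<open>p\<close> kills the
  quotient group, so \<open>p\<close> is the only possible prime divisor of its order. The class of
  1 is nonzero, which gives \<open>f \<ge> 1\<close>.\<close>

lemma card_residue_field_prime_power:
  fixes v :: "'a::field \<Rightarrow> real"
  assumes "nonarch_abs v" "is_subfield F" "prime p" "v (of_nat p) < 1" "card (residue_field v F) \<noteq> 0"
  shows "\<exists>f\<ge>1. card (residue_field v F) = p ^ f"
proof -
  define G where "G = \<lparr>carrier = val_ring v F, monoid.mult = (+), one = 0 :: 'a\<rparr>"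
  have M: "max_ideal v F \<lhd> G" and carr: "carrier (G Mod max_ideal v F) = residue_field v F"
    using val_ring_residue_classes[OF assms(1,2)] by (simp_all add: G_def)
  interpret M: normal "max_ideal v F" G by (rule M)
  interpret Q: group "G Mod max_ideal v F" by (rule M.factorgroup_is_group)
  have pow: "x [^]\<^bsub>G\<^esub> n = of_nat n * x" for x and n :: nat
    by (induction n) (auto simp: G_def algebra_simps)
  have "X [^]\<^bsub>G Mod max_ideal v F\<^esub> p = \<one>\<^bsub>G Mod max_ideal v F\<^esub>" if X: "X \<in> carrier (G Mod max_ideal v F)" for X
  proof -
    obtain x where x: "x \<in> carrier G" "X = max_ideal v F #>\<^bsub>G\<^esub> x"
      using X by (auto simp: carrier_FactGroup)
    have "v (of_nat p * x) < 1"
    proof -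
      have "v (of_nat p * x) = v (of_nat p) * v x" "0 \<le> v (of_nat p)" "0 \<le> v x"
        using assms(1) by (auto simp: nonarch_abs_def)
      moreover have "v x \<le> 1" using x by (simp add: G_def val_ring_def)
      ultimately show ?thesis using assms(4) by (metis le_less_trans mult_left_le)
    qed
    moreover have "x [^]\<^bsub>G\<^esub> p \<in> carrier G" using x by simp
    ultimately have "of_nat p * x \<in> max_ideal v F"
      unfolding pow by (simp add: G_def max_ideal_def val_ring_def)
    then show ?thesis using x M.FactGroup_pow[of x p] pow M.coset_join2[OF _ M.subgroup_axioms] M.subset by auto
  qed
  then have "r = p" if "prime r" "r dvd card (residue_field v F)" for r
    using Q.prime_dvd_exponent_of_prime_dvd_order[of r p] that assms(3,5) carr
    by (metis card.infinite order_def primes_dvd_imp_eq)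
  then obtain f where f: "card (residue_field v F) = p ^ f"
    using eq_prime_power_nat[OF assms(5,3)] by blast
  have "f \<noteq> 0"
  proof
    assume "f = 0"
    then obtain Y where "residue_field v F = {Y}" using f card_1_singletonE by auto
    moreover have "max_ideal v F \<in> residue_field v F" using Q.one_closed carr by simp
    moreover have one: "1 \<in> val_ring v F"
      using assms(2) nonarch_abs_1[OF assms(1)] by (simp add: val_ring_def is_subfield_def)
    then have "max_ideal v F #>\<^bsub>G\<^esub> 1 \<in> residue_field v F"
      unfolding carr[symmetric] carrier_FactGroup by (simp add: G_def)
    ultimately have "max_ideal v F #>\<^bsub>G\<^esub> 1 = max_ideal v F" by simp
    then have "1 \<in> max_ideal v F" using M.rcos_self[OF _ M.subgroup_axioms, of 1] one by (simp add: G_def)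
    then show False using nonarch_abs_1[OF assms(1)] by (simp add: max_ideal_def)
  qed
  then show ?thesis using f by (intro exI[of _ f]) auto
qed

subsection \<open>Levels without borrow\<close>

text \<open>The witnesses come from \<open>q\<^sup>n \<equiv> 1\<close> or \<open>q (mod q\<^sup>2 - 1)\<close>, which makes the residues
  of \<open>k / d\<close> and \<open>(d + q k) / ((q - 1) d)\<close> modulo \<open>q\<^sup>n\<close> explicit. One parity of \<open>n\<close> gives
  the wrong order of these residues; which one depends on \<open>k\<close>.\<close>
lemma residues_mod_power_le:
  fixes q d k :: nat
  assumes q: "2 \<le> q" and d: "d dvd q + 1" and k: "1 \<le> k" "k < d"
  shows "\<exists>r. \<forall>j\<ge>1. \<exists>A m. m \<le> A \<and> A < q ^ (2 * j + r) \<and>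
    int (q ^ (2 * j + r)) dvd int k - int d * int A \<and>
    int (q ^ (2 * j + r)) dvd int (d + q * k) - int ((q - 1) * d) * int m"
proof -
  obtain t where t: "q + 1 = d * t" using d by blast
  have t0: "1 \<le> t" using t by (cases t) auto
  obtain w where w: "\<And>j. int q ^ (2 * j) = 1 + (int q - 1) * int d * int t * w j" "\<And>j. 1 \<le> j \<Longrightarrow> 1 \<le> w j"
  proof -
    have "(int q)\<^sup>2 - 1 dvd ((int q)\<^sup>2) ^ j - 1" for j
      by (metis dvd_triv_left power_diff_1_eq)
    then obtain w where w: "\<And>j. ((int q)\<^sup>2) ^ j - 1 = ((int q)\<^sup>2 - 1) * w j" unfolding dvd_def by metis
    have sq: "(int q)\<^sup>2 - 1 = (int q - 1) * int d * int t"
    proof -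
      have "int d * int t = int q + 1" using t by (metis of_nat_1 of_nat_add of_nat_mult)
      moreover have "(int q)\<^sup>2 - 1 = (int q - 1) * (int q + 1)"
        by (simp add: power2_eq_square algebra_simps)
      ultimately show ?thesis by (simp add: mult.assoc)
    qed
    have pos: "0 < (int q)\<^sup>2 - 1"
    proof -
      have "2 * 2 \<le> int q * int q" using q by (intro mult_mono) auto
      then show ?thesis by (simp add: power2_eq_square)
    qed
    have "1 \<le> w j" if "1 \<le> j" for j
    proof -
      have "1 < ((int q)\<^sup>2) ^ j" using pos q that by (intro one_less_power) auto
      then have "0 < ((int q)\<^sup>2 - 1) * w j" using w[of j] by simp
      then show ?thesis using pos by (simp add: zero_less_mult_iff)
    qed
    moreover have "int q ^ (2 * j) = 1 + (int q - 1) * int d * int t * w j" for j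
      using w[of j] unfolding sq by (simp add: power_mult)
    ultimately show ?thesis using that by blast
  qed
  define P where "P Q \<longleftrightarrow> (\<exists>A m. m \<le> A \<and> A < Q \<and>
    int Q dvd int k - int d * int A \<and> int Q dvd int (d + q * k) - int ((q - 1) * d) * int m)" for Q
  have PI: "P Q" if "0 \<le> m" "m \<le> A" "A < int Q" "int d * A = int k + a * int Q"
    "(int q - 1) * int d * m = int d + int q * int k + b * int Q" for Q A m a b
  proof -
    have "int Q dvd int k - int d * int (nat A)"
      by (rule dvdI[of _ _ "- a"]) (use that in \<open>simp add: algebra_simps\<close>)
    moreover have "int Q dvd int (d + q * k) - int ((q - 1) * d) * int (nat m)"
      by (rule dvdI[of _ _ "- b"]) (use that q in \<open>simp add: algebra_simps of_nat_diff\<close>)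
    ultimately show ?thesis unfolding P_def using that
      by (intro exI[of _ "nat A"] exI[of _ "nat m"]) auto
  qed
  \<comment> \<open>Here \<open>Q\<close> is 1 modulo \<open>(q - 1) * d\<close>. So
    \<open>k + (d - k) * Q\<close> is divisible by \<open>d\<close> and
    \<open>d + q * k + y * Q\<close> by \<open>(q - 1) * d\<close>; the quotients are
    \<open>A\<close> and \<open>m\<close>.\<close>
  have even: "P (q ^ (2 * j))" if j: "1 \<le> j" and "0 \<le> y" "y \<le> (int d - int k) * (int q - 1)"
     "y = int d * int q - 2 * int d - int q * int k" for j y
  proof -
    define u where "u = int t * w j"
    have u: "1 \<le> u" unfolding u_def using mult_mono[of 1 "int t" 1 "w j"] t0 w(2)[OF j] by simp
    have Q: "int (q ^ (2 * j)) = 1 + (int q - 1) * int d * u"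
      using w(1)[of j] by (simp add: u_def mult.assoc)
    show ?thesis
    proof (rule PI[of "1 + y * u" "1 + (int d - int k) * (int q - 1) * u" _ "int d - int k" y])
      show "0 \<le> 1 + y * u" using that u by simp
      show "1 + y * u \<le> 1 + (int d - int k) * (int q - 1) * u"
        using that u by (simp add: mult_right_mono)
      have "0 < int k * (int q - 1) * u" using k q u by simp
      then show "1 + (int d - int k) * (int q - 1) * u < int (q ^ (2 * j))"
        unfolding Q by (simp add: algebra_simps)
    qed (use that u in \<open>simp_all only: Q, simp_all add: algebra_simps\<close>)
  qed
  \<comment> \<open>Now \<open>Q\<close> is \<open>q\<close> modulo \<open>(q - 1) * d\<close>,
    hence -1 modulo \<open>d\<close>, and the multiples of \<open>Q\<close> to be added are
    \<open>k * Q\<close> and \<open>y * Q\<close> with the new \<open>y\<close>.\<close>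
  have odd: "P (q ^ (2 * j + 1))" if j: "1 \<le> j" and "0 \<le> y" "y < int k * (int q - 1)"
     "y = int d * int q - 2 * int d - int k" for j y
  proof -
    define u where "u = int q * int t * w j"
    have u: "int q \<le> u"
    proof -
      have "1 * 1 \<le> int t * w j" using t0 w(2)[OF j] by (intro mult_mono) auto
      then show ?thesis unfolding u_def using q by (simp add: mult.assoc)
    qed
    have Q: "int (q ^ (2 * j + 1)) = int q + (int q - 1) * int d * u"
    proof -
      have "int (q ^ (2 * j + 1)) = int q * int q ^ (2 * j)" by simp
      then show ?thesis unfolding w(1) by (simp add: u_def algebra_simps)
    qed
    have dt: "int d * int t = int q + 1" using t by (metis of_nat_1 of_nat_add of_nat_mult)
    have kt: "0 \<le> int k * int t" by simp
    show ?thesis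
    proof (rule PI[of "int q - 1 + y * u" "int k * (int t + (int q - 1) * u)" _ "int k" y])
      show "0 \<le> int q - 1 + y * u" using that q u by simp
      \<comment> \<open>Strictness of \<open>y < k * (q - 1)\<close> leaves a spare
        \<open>u \<ge> q\<close>, which absorbs the \<open>q - 1\<close> in
        \<open>m\<close>.\<close>
      have "(y + 1) * u \<le> int k * (int q - 1) * u" using that u q by (intro mult_right_mono) auto
      then show "int q - 1 + y * u \<le> int k * (int t + (int q - 1) * u)"
        using u kt unfolding distrib_left distrib_right mult.assoc by linarith
      have "int k * (int q + 1) < int d * (int q + (int q - 1) * int d * u) - int k * ((int q - 1) * int d * u)"
      proof -
        have "int k * int q \<le> int d * int q" using k by (intro mult_right_mono) auto
        moreover have "int k < (int d - int k) * ((int q - 1) * int d * u)"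
        proof -
          have "1 * (1 * int d * 1) \<le> (int d - int k) * ((int q - 1) * int d * u)"
            using k q u by (intro mult_mono) auto
          then show ?thesis using k unfolding mult_1 mult_1_right by linarith
        qed
        ultimately show ?thesis by (simp add: algebra_simps)
      qed
      then have "int d * (int k * (int t + (int q - 1) * u)) < int d * int (q ^ (2 * j + 1))"
        unfolding Q dt[symmetric] by (simp add: algebra_simps)
      then show "int k * (int t + (int q - 1) * u) < int (q ^ (2 * j + 1))"
        using k by simp
      show "int d * (int k * (int t + (int q - 1) * u)) = int k + int k * int (q ^ (2 * j + 1))"
      proof -
        have "int d * (int k * (int t + (int q - 1) * u)) = int k * (int d * int t) + int k * ((int q - 1) * int d * u)"
          by (simp add: algebra_simps)
        then show ?thesis unfolding Q dt by (simp add: algebra_simps)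
      qed
    qed (use that in \<open>simp_all only: Q, simp_all add: algebra_simps\<close>)
  qed
  have "(\<forall>j\<ge>1. P (q ^ (2 * j))) \<or> (\<forall>j\<ge>1. P (q ^ (2 * j + 1)))"
  \<comment> \<open>For \<open>q = 2\<close> the only choice is \<open>d = 3\<close>, and the
    relevant \<open>y\<close> is -2; the representative \<open>-2 + (q - 1) * d = 1\<close> replaces
    it.\<close>
  proof (cases "q = 2")
    case True
    then have dt: "d * t = 3" using t by simp
    then have "d \<le> 3" using dvd_imp_le[of d 3] by (metis dvd_triv_left zero_less_numeral)
    then have "d = 2 \<or> d = 3" using k by linarith
    then have d3: "d = 3" and t1: "t = 1" using dt by presburger+
    have "P (2 ^ (2 * j))" if "k = 1" "1 \<le> j" for j
      by (rule PI[of "2 + w j" "1 + 2 * w j" _ 2 1]) (use w[of j] that d3 t1 True in simp_all)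
    moreover have "P (2 ^ (2 * j + 1))" if "k = 2" "1 \<le> j" for j
      by (rule PI[of "3 + 2 * w j" "2 * (1 + 2 * w j)" _ 2 1]) (use w[of j] that d3 t1 True in simp_all)
    moreover have "k = 1 \<or> k = 2" using k d3 by auto
    ultimately show ?thesis using True by auto
  next
    case False
    then have q3: "3 \<le> q" using q by simp
    let ?y = "int d * int q - 2 * int d - int q * int k" and ?z = "int d * int q - 2 * int d - int k"
    show ?thesis
    \<comment> \<open>A negative \<open>?y\<close> means exactly \<open>?z < k * (q - 1)\<close>,
      the condition of the odd case.\<close>
    proof (cases "0 \<le> ?y")
      case True
      then show ?thesis using even[OF _ True] by (simp add: algebra_simps)
    next
      case False
      moreover have "0 \<le> ?z"
      proof -
        have "int d * 3 \<le> int d * int q" using q3 by (intro mult_left_mono) auto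
        then show ?thesis using k by linarith
      qed
      ultimately show ?thesis using odd[of _ ?z] by (simp add: algebra_simps)
    qed
  qed
  then show ?thesis unfolding P_def by (metis add.right_neutral)
qed

context padic_norm
begin

lemma infinite_no_borrow:
  assumes q: "q = p ^ f" "1 \<le> f" and d: "d dvd q + 1" and k: "1 \<le> k" "k < d"
    and cop: "coprime d p"
  shows "infinite (no_borrow (int (d + q * k)) (int k) d (q - 1))"
  unfolding infinite_nat_iff_unbounded_le
proof
  fix n0
  have "p ^ 1 \<le> q" unfolding q(1) using q(2) prime_gt_0_nat[OF prime_p] by (intro power_increasing) auto
  then have q2: "2 \<le> q" using prime_ge_2_nat[OF prime_p] by simp
  obtain r where r: "\<And>j. 1 \<le> j \<Longrightarrow> \<exists>A m. m \<le> A \<and> A < q ^ (2 * j + r) \<and>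
    int (q ^ (2 * j + r)) dvd int k - int d * int A \<and>
    int (q ^ (2 * j + r)) dvd int (d + q * k) - int ((q - 1) * d) * int m"
    using residues_mod_power_le[OF q2 d k] by blast
  define L where "L = f * (2 * (n0 + 1) + r)"
  have L: "q ^ (2 * (n0 + 1) + r) = p ^ L" unfolding L_def q(1) by (rule power_mult[symmetric])
  obtain A m where Am: "m \<le> A" "A < p ^ L" "int p ^ L dvd int k - int d * int A"
      "int p ^ L dvd int (d + q * k) - int ((q - 1) * d) * int m"
    using r[of "n0 + 1"] unfolding L by auto
  \<comment> \<open>\<open>m\<close> merely bounds the least solution from above, while
    \<open>A < p ^ L\<close> is the residue itself.\<close>
  have "root_mod (int (d + q * k)) ((q - 1) * d) L \<le> m"
    unfolding root_mod_def by (rule Least_le) (rule Am)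
  also have "m \<le> root_mod (int k) d L" using Am root_mod_dvd_iff[OF cop, of L "int k" A] by simp
  finally have "L \<in> no_borrow (int (d + q * k)) (int k) d (q - 1)"
    unfolding no_borrow_def by (rule CollectI)
  moreover have "1 * n0 \<le> L" unfolding L_def using q(2) by (intro mult_le_mono) auto
  ultimately show "\<exists>n\<ge>n0. n \<in> no_borrow (int (d + q * k)) (int k) d (q - 1)" by auto
qed


section \<open>Unboundedness of the coefficients\<close>

lemma v_fps_compose_X_power_le_1:
  assumes "\<And>n. v (fps_nth f n) \<le> 1"
  shows "v (fps_nth (f oo fps_X ^ e) n) \<le> 1"
proof -
  have "v (fps_nth f i * fps_nth ((fps_X ^ e) ^ i) n) \<le> 1" for i
    using assms[of i] v_eq_0[of 0] by (simp add: power_mult[symmetric])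
  then show ?thesis unfolding fps_compose_nth by (intro v_sum_le) auto
qed

text \<open>A bound for \<open>zeta\<close> would bound \<open>bracket_sum\<close>, as the factor
  \<open>\<B>\<close> has coefficients of absolute value at most 1. But \<open>v_sum_gchoose\<close>
  gives coefficients that grow with the number of no-borrow levels.\<close>

lemma zeta_coeffs_unbounded:
  fixes \<pi> :: 'a
  assumes pi: "\<pi> \<noteq> 0" and q: "q = p ^ f" "1 \<le> f" and d: "d dvd q + 1" and k: "1 \<le> k" "k < d"
  shows "\<not> bdd_above (range (\<lambda>n. v (fps_nth (zeta \<pi> q d k) n)))"
proof
  assume "bdd_above (range (\<lambda>n. v (fps_nth (zeta \<pi> q d k) n)))"
  then obtain B where B: "\<And>n. v (fps_nth (zeta \<pi> q d k) n) \<le> B"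
    by (auto simp: bdd_above_def)
  have B0: "0 \<le> B" using B[of 0] v_nonneg order_trans by blast
  have "p ^ 1 \<le> q" unfolding q(1) using q(2) prime_gt_0_nat[OF prime_p] by (intro power_increasing) auto
  then have q2: "2 \<le> q" using prime_ge_2_nat[OF prime_p] by simp
  have p_q: "p dvd q" unfolding q(1) using q(2) by (intro dvd_power) auto
  have cop: "coprime d p"
    using coprime_divisors[OF d p_q] by (simp add: coprime_add_one_left)
  have cope: "coprime (q - 1) p"
    using coprime_divisors[OF dvd_refl p_q] coprime_diff_one_left_nat[of q] q2 by auto
  have nz: "int k - int d * int i \<noteq> 0" for i
  proof
    assume "int k - int d * int i = 0"
    then have "k = d * i" by (metis eq_iff_diff_eq_0 of_nat_eq_iff of_nat_mult)
    then show False using k by (cases i) auto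
  qed
  define c where "c = int (d + q * k)"
  define \<B> where "\<B> = (binom_series (of_nat k / of_nat d) oo fps_X ^ (q - 1) :: 'a fps)"
  have \<B>_le: "v (fps_nth \<B> n) \<le> 1" for n
    unfolding \<B>_def
  proof (rule v_fps_compose_X_power_le_1)
    fix n
    show "v (fps_nth (binom_series (of_nat k / of_nat d)) n) \<le> 1"
      using v_gchoose_le_1[OF cop, of "int k" n]
      unfolding binom_series_def fps_nth_Abs_fps v_mult v_power v_minus v_one by simp
  qed
  have bounded: "v (fps_nth (bracket_sum q d k) n) \<le> B / v \<pi>" for n
  proof -
    have "v (fps_nth (zeta \<pi> q d k) i * fps_nth \<B> j) \<le> B" for i j
      using mult_mono[OF B[of i] \<B>_le[of j]] B0 v_nonneg by (simp add: v_mult)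
    then have "v (fps_nth (zeta \<pi> q d k * \<B>) n) \<le> B"
      unfolding fps_mult_nth using B0 by (intro v_sum_le) auto
    also have "zeta \<pi> q d k * \<B> = fps_const \<pi> * bracket_sum q d k"
      unfolding \<B>_def bracket_sum_eq_zeta_mult[OF q2] ..
    finally have "v \<pi> * v (fps_nth (bracket_sum q d k) n) \<le> B" by (simp add: v_mult)
    moreover have "0 < v \<pi>" using pi v_nonneg[of \<pi>] v_eq_0[of \<pi>] by simp
    ultimately show ?thesis by (simp add: field_simps)
  qed
  define NB where "NB = no_borrow c (int k) d (q - 1)"
  \<comment> \<open>Level 0 is dropped: both residues are 0 there, and the count runs over
    \<open>{1..L}\<close>.\<close>
  have inf: "infinite (NB - {0})"
    unfolding NB_def c_def using infinite_no_borrow[OF q d k cop] by simp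
  have "1 < inverse \<rho>" using rho by (simp add: one_less_inverse)
  then obtain g where g: "B / v \<pi> < inverse \<rho> ^ g" using real_arch_pow by blast
  obtain T where T: "finite T" "card T = Suc g" "T \<subseteq> NB - {0}"
    using infinite_arbitrarily_large[OF inf] by blast
  \<comment> \<open>The maximum is itself a no-borrow level, as \<open>v_sum_gchoose\<close>
    requires, and all of \<open>T\<close> lies in \<open>{1..L}\<close>.\<close>
  define L where "L = Max T"
  have "T \<noteq> {}" using T by auto
  then have "L \<in> T" unfolding L_def using T(1) by (rule Max_in[rotated])
  then have L: "L \<in> NB" "1 \<le> L" using T by auto
  have "T \<subseteq> NB \<inter> {1..L}" using T unfolding L_def by (auto simp: Suc_le_eq)
  then have "g \<le> card (NB \<inter> {1..L})" using T(2) card_mono[of "NB \<inter> {1..L}" T] by auto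
  then have "inverse \<rho> ^ g \<le> inverse \<rho> ^ card (NB \<inter> {1..L})"
    using \<open>1 < inverse \<rho>\<close> by (intro power_increasing) auto
  then have large: "B / v \<pi> < inverse (\<rho> ^ card (NB \<inter> {1..L}))"
    using g by (simp add: power_inverse)
  define m0 where "m0 = root_mod c ((q - 1) * d) L"
  define N where "N = (q - 1) * m0 + p ^ L"
  have "0 < N" using prime_gt_0_nat[OF prime_p] by (simp add: N_def)
  have mu: "(mu q d k m :: 'a) = of_int (c - int ((q - 1) * d * m)) / of_nat d" for m
    using coprime_p_pos[OF cop] q2 by (simp add: mu_def c_def field_simps of_nat_diff)
  have "v (fps_nth (bracket_sum q d k) (N - 1)) = inverse (\<rho> ^ card (NB \<inter> {1..L}))"
    unfolding bracket_sum_nth[OF q2 d k \<open>0 < N\<close>] mu NB_def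
    using v_sum_gchoose[OF cop cope nz L(1)[unfolded NB_def] L(2) m0_def N_def,
        of "\<lambda>m. (- 1) ^ (m + (N - (q - 1) * m))"]
    by (simp only: of_int_of_nat_eq v_power v_minus v_one power_one)
  then show False using bounded[of "N - 1"] large by simp
qed

end

theorem theorem6p3p18:
  fixes v :: "'k::field_char_0 \<Rightarrow> real"
    and Qp F :: "'k set" and \<pi>\<^sub>F :: 'k and p q d k :: nat
  assumes "prime p"
    and "nonarch_abs v"
    and "Metric_space.mcomplete UNIV (abs_dist v)"
    and "padic_numbers p v Qp"
    and "finite_extension Qp F"
    and "uniformiser v F \<pi>\<^sub>F"
    and "q = card (residue_field v F)"
    and "d \<ge> 1" and "d dvd q + 1"
    and "1 \<le> k" and "k < d"
  shows "\<not> bdd_above (range (\<lambda>n. v (fps_nth (zeta \<pi>\<^sub>F q d k) n)))"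
proof -
  obtain c where c: "0 < c" "\<And>r. v (of_rat r) = padic_abs p r powr c"
    using assms(4) by (auto simp: padic_numbers_def)
  define \<rho> where "\<rho> = real p powr (- c)"
  have p1: "1 < real p" using prime_gt_1_nat[OF assms(1)] by simp
  have rho: "0 < \<rho>" "\<rho> < 1" using p1 c(1) powr_less_one[of "real p" "- c"] by (auto simp: \<rho>_def)
  have "v (of_int x) = \<rho> ^ multiplicity (int p) x" if "x \<noteq> 0" for x
  proof -
    have "v (of_int x) = padic_abs p (of_int x) powr c" using c(2)[of "of_int x"] by simp
    also have "\<dots> = (real p powr (- real (multiplicity (int p) x))) powr c"
      using that p1 by (simp add: padic_abs_def powr_real_of_int'[symmetric])
    also have "\<dots> = \<rho> powr real (multiplicity (int p) x)"
      by (simp add: \<rho>_def powr_powr mult.commute)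
    finally show ?thesis using rho by (simp add: powr_realpow)
  qed
  then interpret padic_norm v p \<rho>
    using assms(1,2) rho by unfold_locales auto
  have F: "is_subfield F" using assms(5) by (simp add: finite_extension_def)
  have v_p: "v (of_nat p) < 1"
    using v_of_nat[of p] p1 rho assms(1) by (simp add: multiplicity_self)
  \<comment> \<open>An infinite residue field has \<open>card\<close> 0; then \<open>q = 0\<close>
    and \<open>d = 1\<close>, against \<open>1 \<le> k < d\<close>.\<close>
  have "card (residue_field v F) \<noteq> 0"
    using assms(7,9-11) by (intro notI) simp
  then obtain f where f: "1 \<le> f" "q = p ^ f"
    using card_residue_field_prime_power[OF assms(2) F assms(1) v_p] assms(7) by auto
  have "of_nat n \<in> F" for n
  proof (induction n)
    case (Suc n)
    have "1 - (0 - of_nat n) \<in> F" using F Suc unfolding is_subfield_def by metis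
    then show ?case by simp
  qed (use F in \<open>simp add: is_subfield_def\<close>)
  \<comment> \<open>The maximal ideal contains the nonzero element \<open>p\<close>, so its
    generator cannot be 0.\<close>
  then have "of_nat p \<in> max_ideal v F" using v_p by (simp add: max_ideal_def)
  then have "\<pi>\<^sub>F \<noteq> 0" using assms(6) p1 unfolding uniformiser_def by auto
  then show ?thesis by (rule zeta_coeffs_unbounded[OF _ f(2,1) assms(9-11)])
qed

end
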